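(* Let $\alpha > 0$ and let $\mathbf{x} \in \mathbb{R}^m$ satisfy $\|\mathbf{x}\|_1 > \alpha$. Let $\tau$ be the threshold calculated by the algorithm (described in the context) for finding the proximal operator $\mathbf{prox}_{\alpha\|\cdot\|_\infty}(\mathbf{x})$, and let $\tau_{\text{simplex}}$ be the threshold calculated by the algorithm (described in the context) for finding the projection $\mathcal{P}_{\|\cdot\|_1=\alpha}(|\mathbf{x}|)$ of $|\mathbf{x}|$ onto the simplex. Then $\tau = \tau_{\text{simplex}}$.
   Context: $|\mathbf{x}| = (|\mathbf{x}_1|,\ldots,|\mathbf{x}_m|)$. The proximal operator is $\mathbf{prox}_{\alpha\|\cdot\|_\infty}(\mathbf{x}) = \arg\min_{\mathbf{y}\in\mathbb{R}^m}\left(\frac12\|\mathbf{y}-\mathbf{x}\|_2^2 + \alpha\|\mathbf{y}\|_\infty\right)$. The projection onto the simplex is $\mathcal{P}_{\|\cdot\|_1=\alpha}(\mathbf{v}) = \arg\min\{\frac12\|\mathbf{y}-\mathbf{v}\|_2^2 : \|\mathbf{y}\|_1=\alpha,\ \mathbf{y}_i\ge 0 \text{ for all } i\}$. Let $\mathbf{s}$ be the entries of $|\mathbf{x}|$ sorted so that $\mathbf{s}_1 \geq \cdots \geq \mathbf{s}_m \geq 0$, and set $\mathbf{s}_{m+1} = 0$. Algorithm for the proximal operator (case $\|\mathbf{x}\|_1>\alpha$): run, in increasing order, through the indices $i \in \{1,\ldots,m\}$ that are the last index of a maximal block of equal values among $\mathbf{s}_1,\ldots,\mathbf{s}_m$ (i.e.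 $i=m$ or $\mathbf{s}_{i+1}<\mathbf{s}_i$). For each, compute $t_0 = \frac{1}{i}\left(\sum_{k=1}^i \mathbf{s}_k - \alpha\right)$; at the first such $i$ with $\mathbf{s}_{i+1} < t_0 \leq \mathbf{s}_i$, set $\tau = t_0$ and stop. (The output is then the vector obtained by clipping each $\mathbf{x}_k$ to $[-\tau,\tau]$.) Algorithm for projection onto the simplex, applied to $|\mathbf{x}|$: let $i^* = \max\left\{ i \in \{1,\ldots,m\} : \frac{1}{i}\left(\sum_{k=1}^i \mathbf{s}_k - \alpha\right) < \mathbf{s}_i\right\}$ and set $\tau_{\text{simplex}} = \frac{1}{i^*}\left(\sum_{k=1}^{i^*}\mathbf{s}_k - \alpha\right)$. (The output is then the vector with entries $\max\{|\mathbf{x}_k| - \tau_{\text{simplex}}, 0\}$.) *)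

theory Defs
  imports "HOL-Analysis.Analysis" "HOL-Library.Multiset"
begin

text \<open>The indices run from 1, and \<open>sorted_desc v i\<close> is 0 for \<open>i > CARD('m)\<close>: this is the convention
  \<open>s (m + 1) = 0\<close>.\<close>

definition sorted_desc :: "real ^ 'm \<Rightarrow> nat \<Rightarrow> real" where
  "sorted_desc v i =
     (if i \<in> {1..CARD('m)}
      then rev (sorted_list_of_multiset (image_mset (\<lambda>j. v $ j) (mset_set UNIV))) ! (i - 1)
      else 0)"

definition candidate :: "real \<Rightarrow> (nat \<Rightarrow> real) \<Rightarrow> nat \<Rightarrow> real" where
  "candidate \<alpha> s i = ((\<Sum>k=1..i. s k) - \<alpha>) / real i"

definition block_ends :: "(nat \<Rightarrow> real) \<Rightarrow> nat \<Rightarrow> nat list" where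
  "block_ends s m = filter (\<lambda>i. i = m \<or> s (i + 1) < s i) [1..<m + 1]"

text \<open>\<open>find\<close> returns the first list element with the given property; the result is \<open>None\<close> if the
  loop ends without meeting the stopping criterion. The algorithm is meant for inputs whose 1-norm
  exceeds \<open>\<alpha>\<close>.\<close>

definition prox_linf_threshold :: "real \<Rightarrow> real ^ 'm \<Rightarrow> real option" where
  "prox_linf_threshold \<alpha> x =
     (let s = sorted_desc \<bar>x\<bar>;
          t = candidate \<alpha> s
      in map_option t (find (\<lambda>i. s (i + 1) < t i \<and> t i \<le> s i) (block_ends s CARD('m))))"

definition simplex_threshold :: "real \<Rightarrow> real ^ 'm \<Rightarrow> real" where
  "simplex_threshold \<alpha> v =
     (let s = sorted_desc v;
          t = candidate \<alpha> s
      in t (Max {i \<in> {1..CARD('m)}. t i < s i}))"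

end

theory Submission
  imports Defs
begin

text \<open>For the nonincreasing sequence \<open>s\<close> put \<open>F i = (\<Sum>k=1..i. s k) - i * s i\<close>. Then
  \<open>F (i + 1) - F i = i * (s i - s (i + 1)) \<ge> 0\<close>, and the two algorithms only look at how \<open>F\<close> crosses
  the level \<open>\<alpha>\<close>: the simplex test \<open>t i < s i\<close> says \<open>F i < \<alpha>\<close>, while the stopping criterion
  \<open>s (i + 1) < t i \<le> s i\<close> says \<open>F i \<le> \<alpha> < F (i + 1)\<close>. So the first algorithm selects the last index with
  \<open>F i \<le> \<alpha>\<close>, the second the last index with \<open>F i < \<alpha>\<close>; between the two, \<open>F = \<alpha>\<close> and the candidate
  threshold is constant.\<close>

definition excess :: "(nat \<Rightarrow> real) \<Rightarrow> nat \<Rightarrow> real" where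
  "excess s i = (\<Sum>k=1..i. s k) - real i * s i"

text \<open>The new term \<open>s (Suc i)\<close> cancels one of the \<open>Suc i\<close> copies
  subtracted, so the excess at \<open>Suc i\<close> involves the same partial sum as the candidate
  at \<open>i\<close>.\<close>

lemma excess_Suc: "excess s (Suc i) = (\<Sum>k=1..i. s k) - real i * s (Suc i)"
  by (simp add: excess_def algebra_simps)

lemma excess_Suc_diff: "excess s (Suc i) - excess s i = real i * (s i - s (Suc i))"
  by (simp add: excess_def algebra_simps)

lemma mono_excess:
  assumes "\<And>i. 1 \<le> i \<Longrightarrow> s (Suc i) \<le> s i"
  shows "mono (excess s)"
proof (rule mono_iff_le_Suc[THEN iffD2], rule allI)
  fix i
  \<comment> \<open>At \<open>i = 0\<close> nothing is assumed about \<open>s\<close>, but the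
    factor \<open>real i\<close> vanishes.\<close>
  have "0 \<le> real i * (s i - s (Suc i))"
    using assms[of i] by (cases "i = 0") auto
  then show "excess s i \<le> excess s (Suc i)"
    using excess_Suc_diff[of s i] by linarith
qed

lemma candidate_less_iff: "1 \<le> i \<Longrightarrow> candidate \<alpha> s i < s i \<longleftrightarrow> excess s i < \<alpha>"
  by (auto simp: candidate_def excess_def field_simps)

lemma candidate_le_iff: "1 \<le> i \<Longrightarrow> candidate \<alpha> s i \<le> s i \<longleftrightarrow> excess s i \<le> \<alpha>"
  by (auto simp: candidate_def excess_def field_simps)

lemma less_candidate_iff: "1 \<le> i \<Longrightarrow> s (Suc i) < candidate \<alpha> s i \<longleftrightarrow> \<alpha> < excess s (Suc i)"
  by (auto simp: candidate_def excess_Suc field_simps)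

text \<open>Both candidates equal \<open>s (Suc i)\<close>.\<close>

lemma candidate_Suc_eq:
  assumes "1 \<le> i" and "excess s (Suc i) = \<alpha>"
  shows "candidate \<alpha> s (Suc i) = candidate \<alpha> s i"
proof -
  have "candidate \<alpha> s i = s (Suc i)"
    using assms by (auto simp: candidate_def excess_Suc field_simps)
  moreover have "candidate \<alpha> s (Suc i) = s (Suc i)"
    using assms by (auto simp: candidate_def excess_def field_simps)
  ultimately show ?thesis by simp
qed

text \<open>Each step uses the excess at its right end only, so at \<open>i\<close> itself the
  excess may still lie below \<alpha>.\<close>

lemma candidate_const:
  assumes "1 \<le> i" and "i \<le> j" and "\<And>k. i < k \<Longrightarrow> k \<le> j \<Longrightarrow> excess s k = \<alpha>"
  shows "candidate \<alpha> s j = candidate \<alpha> s i"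
  using assms(2,3)
proof (induction j rule: dec_induct)
  case (step n)
  then show ?case using candidate_Suc_eq[of n s \<alpha>] assms(1) by simp
qed simp

text \<open>When a single element satisfies \<open>P\<close>, the order of the search is
  irrelevant.\<close>

lemma find_eq_Some_unique:
  assumes "a \<in> set xs" and "P a" and "\<And>b. b \<in> set xs \<Longrightarrow> P b \<Longrightarrow> b = a"
  shows "find P xs = Some a"
proof (cases "find P xs")
  case None
  then show ?thesis using assms(1,2) by (auto simp: find_None_iff)
next
  case (Some b)
  then show ?thesis using assms(3)[of b] by (auto simp: find_Some_iff)
qed

lemma find_block_ends_eq_simplex:
  fixes s :: "nat \<Rightarrow> real"
  assumes desc: "\<And>i. 1 \<le> i \<Longrightarrow> s (Suc i) \<le> s i"
    and "1 \<le> m" and "s (Suc m) = 0" and "0 < \<alpha>" and "\<alpha> < (\<Sum>k=1..m. s k)"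
  defines "t \<equiv> candidate \<alpha> s"
  shows "map_option t (find (\<lambda>i. s (i + 1) < t i \<and> t i \<le> s i) (block_ends s m)) =
    Some (t (Max {i \<in> {1..m}. t i < s i}))"
proof -
  define A where "A = {i \<in> {1..m}. excess s i < \<alpha>}"
  define B where "B = {i \<in> {1..m}. excess s i \<le> \<alpha>}"
  define p where "p = Max B"
  have mono: "excess s i \<le> excess s j" if "i \<le> j" for i j
    using mono_excess[of s] desc that by (auto dest: monoD)
  have one: "excess s 1 = 0"
    by (simp add: excess_def)
  \<comment> \<open>Because \<open>s (Suc m) = 0\<close>, this excess is the full sum: \<alpha> is
    crossed at \<open>Suc m\<close> at the latest.\<close>
  have top: "\<alpha> < excess s (Suc m)"
    using assms by (simp add: excess_Suc)
  have fin: "finite A" "finite B" and ne: "A \<noteq> {}" "B \<noteq> {}"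
    using one \<open>1 \<le> m\<close> \<open>0 < \<alpha>\<close> by (auto simp: A_def B_def intro!: exI[of _ 1])
  have "p \<in> B" unfolding p_def by (rule Max_in[OF fin(2) ne(2)])
  then have p: "1 \<le> p" "p \<le> m" "excess s p \<le> \<alpha>"
    by (auto simp: B_def)
  have above_p: "\<alpha> < excess s (Suc p)"
  proof (cases "p = m")
    case False
    have "Suc p \<notin> B" using Max_ge[OF fin(2), of "Suc p"] by (auto simp: p_def)
    then show ?thesis using False p by (auto simp: B_def)
  qed (use top in simp)
  \<comment> \<open>A strict increase of the excess forces a strict drop of \<open>s\<close>, so
    \<open>p\<close> ends a block.\<close>
  have "0 < real p * (s p - s (Suc p))"
    using excess_Suc_diff[of s p] p(3) above_p by linarith
  then have "s (Suc p) < s p"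
    by (simp add: zero_less_mult_iff)
  then have "p \<in> set (block_ends s m)"
    using p by (auto simp: block_ends_def)
  moreover have "s (p + 1) < t p \<and> t p \<le> s p"
    using p above_p by (simp add: t_def candidate_le_iff less_candidate_iff)
  moreover have "b = p" if "b \<in> set (block_ends s m)" "s (b + 1) < t b \<and> t b \<le> s b" for b
  proof -
    have "1 \<le> b" using that(1) by (auto simp: block_ends_def)
    then have b: "excess s b \<le> \<alpha>" "\<alpha> < excess s (Suc b)"
      using that(2) by (auto simp: t_def candidate_le_iff less_candidate_iff)
    \<comment> \<open>A monotone sequence crosses the level \<alpha> only once.\<close>
    have "\<not> Suc p \<le> b" using mono[of "Suc p" b] b(1) above_p by linarith
    moreover have "\<not> Suc b \<le> p" using mono[of "Suc b" p] b(2) p(3) by linarith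
    ultimately show ?thesis by simp
  qed
  ultimately have find: "find (\<lambda>i. s (i + 1) < t i \<and> t i \<le> s i) (block_ends s m) = Some p"
    by (rule find_eq_Some_unique)
  have "Max A \<in> A" by (rule Max_in[OF fin(1) ne(1)])
  then have q: "1 \<le> Max A" "Max A \<le> p"
    using Max_ge[OF fin(2), of "Max A"] by (auto simp: A_def B_def p_def)
  have "t p = t (Max A)"
    unfolding t_def
  proof (rule candidate_const[OF q])
    fix k assume k: "Max A < k" "k \<le> p"
    then have "k \<notin> A" using Max_ge[OF fin(1), of k] by auto
    \<comment> \<open>Maximality of \<open>Max A\<close> gives the lower bound, monotonicity up to
      \<open>p\<close> the upper one.\<close>
    then show "excess s k = \<alpha>"
      using k q p mono[of k p] by (auto simp: A_def)
  qed
  moreover have "{i \<in> {1..m}. t i < s i} = A"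
    by (auto simp: A_def t_def candidate_less_iff)
  ultimately show ?thesis unfolding find by simp
qed

lemma length_sorted_list_components:
  fixes v :: "real ^ 'm"
  shows "length (sorted_list_of_multiset (image_mset (\<lambda>j. v $ j) (mset_set UNIV))) = CARD('m)"
  by (metis mset_sorted_list_of_multiset size_image_mset size_mset size_mset_set)

text \<open>Nonnegativity enters at \<open>i = CARD('m)\<close>, where the next value is the default
  0; for larger \<open>i\<close> both sides are 0.\<close>

lemma sorted_desc_Suc_le:
  fixes v :: "real ^ 'm"
  assumes "\<And>j. 0 \<le> v $ j" and "1 \<le> i"
  shows "sorted_desc v (Suc i) \<le> sorted_desc v i"
proof -
  define xs where "xs = sorted_list_of_multiset (image_mset (\<lambda>j. v $ j) (mset_set UNIV))"
  have len: "length xs = CARD('m)"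
    unfolding xs_def by (rule length_sorted_list_components)
  have nonneg: "0 \<le> y" if "y \<in> set xs" for y
    using that assms(1) by (auto simp: xs_def)
  have "sorted xs"
    by (simp add: xs_def)
  then have mono: "rev xs ! i \<le> rev xs ! (i - 1)" if "i < length xs"
    using that sorted_rev_nth_mono[of "rev xs" "i - 1" i] by simp
  have "0 \<le> rev xs ! (i - 1)" if "i \<le> length xs"
    using that assms(2) nonneg[of "rev xs ! (i - 1)"]
    by (metis One_nat_def Suc_le_lessD Suc_pred length_rev nth_mem set_rev)
  then show ?thesis
    using assms(2) mono unfolding sorted_desc_def xs_def[symmetric] by (auto simp: len)
qed

lemma sum_sorted_desc:
  fixes v :: "real ^ 'm"
  shows "(\<Sum>k=1..CARD('m). sorted_desc v k) = (\<Sum>j\<in>UNIV. v $ j)"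
proof -
  define xs where "xs = sorted_list_of_multiset (image_mset (\<lambda>j. v $ j) (mset_set UNIV))"
  have len: "length xs = CARD('m)"
    unfolding xs_def by (rule length_sorted_list_components)
  have "(\<Sum>k=1..CARD('m). sorted_desc v k) = (\<Sum>k=1..CARD('m). rev xs ! (k - 1))"
    unfolding sorted_desc_def xs_def[symmetric] by (intro sum.cong) auto
  also have "\<dots> = (\<Sum>k<CARD('m). rev xs ! k)"
    by (rule sum.reindex_bij_witness[of _ Suc "\<lambda>k. k - 1"]) auto
  also have "\<dots> = sum_list (rev xs)"
    by (simp add: sum_list_sum_nth len atLeast0LessThan)
  \<comment> \<open>Passing to multisets forgets both the reversal and the sorting.\<close>
  also have "\<dots> = sum_mset (mset xs)"
    by (simp add: sum_mset_sum_list)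
  also have "\<dots> = (\<Sum>j\<in>UNIV. v $ j)"
    by (simp add: xs_def sum_unfold_sum_mset)
  finally show ?thesis .
qed

theorem theorem3p2:
  fixes \<alpha> :: real and x :: "real ^ 'm"
  assumes "\<alpha> > 0"
    and "(\<Sum>j\<in>UNIV. \<bar>x $ j\<bar>) > \<alpha>"
  shows "prox_linf_threshold \<alpha> x = Some (simplex_threshold \<alpha> \<bar>x\<bar>)"
proof -
  have abs: "\<bar>x\<bar> $ j = \<bar>x $ j\<bar>" for j
    by (simp add: abs_vec_def)
  show ?thesis
    unfolding prox_linf_threshold_def simplex_threshold_def Let_def
  proof (rule find_block_ends_eq_simplex)
    show "sorted_desc \<bar>x\<bar> (Suc i) \<le> sorted_desc \<bar>x\<bar> i" if "1 \<le> i" for i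
      using that by (intro sorted_desc_Suc_le) (auto simp: abs)
    show "1 \<le> CARD('m)" by (simp add: Suc_leI)
    show "sorted_desc \<bar>x\<bar> (Suc CARD('m)) = 0" by (simp add: sorted_desc_def)
    show "\<alpha> < (\<Sum>k=1..CARD('m). sorted_desc \<bar>x\<bar> k)"
      using assms(2) by (simp only: sum_sorted_desc abs)
  qed (rule assms(1))
qed

end
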